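(* For all positive integers $r$, $k$, $t$ and $s$ satisfying $\max(t+1,s)\le k$, there is a constant $\Lambda = \Lambda(r,k,t,s)$ such that $$\lim_{n\to \infty} \binom{n}{s}^{-1} M(n,r,k,t,s) = \Lambda.$$
   Context: $K_n^k$ denotes the complete $k$-uniform hypergraph on a vertex set $V_n$ of size $n$, where $n\ge k\ge 2$ (its edges are all $k$-subsets of $V_n$). Hypergraphs are identified with their edge sets. For a hypergraph or edge set $H$ and a positive integer $s$, the $s$-shadow is $E^{(s)}(H)=\{S : |S|=s,\ \exists e\in H: S\subseteq e\}$. For a hypergraph $H$, the $t$-tight components of $H$ are the classes of the partition of the edges of $H$ obtained by starting from singletons (one per edge) and iteratively merging two classes whenever one contains an edge $e$ and the other an edge $f$ with $|e\cap f|\ge t$, until no further merging is possible; $TC_t(H)$ is the family of these edge sets. $\mathrm{Col}_r(H)$ is the family of all (not necessarily proper) colorings of the edges of $H$ with colors $1,\dots,r$ (not all colors need be used). For $\mathbf{c}\in \mathrm{Col}_r(K_n^k)$ let $H_i=H_i(\mathbf{c})$ be the $k$-uniform hypergraph of all edges of color $i$, and define $$M(n,r,k,t,s;\mathbf{c})=\max_{i\in\{1,\dots,r\}}\ \max_{C\in TC_t(H_i)}|E^{(s)}(C)|$$ (color classes with no edges are ignored), and $M(n,r,k,t,s)=\min_{\mathbf{c}\in \mathrm{Col}_r(K_n^k)} M(n,r,k,t,s;\mathbf{c})$. *)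

theory Defs
  imports Complex_Main "HOL-Library.FuncSet"
begin

type_synonym 'a hypergraph = "'a set set"

definition complete_hypergraph :: "nat \<Rightarrow> 'a set \<Rightarrow> 'a hypergraph" where
  "complete_hypergraph k V = {e. e \<subseteq> V \<and> card e = k}"

definition shadow :: "nat \<Rightarrow> 'a hypergraph \<Rightarrow> 'a hypergraph" where
  "shadow s H = {S. card S = s \<and> (\<exists>e\<in>H. S \<subseteq> e)}"

inductive merge_step :: "nat \<Rightarrow> 'a hypergraph set \<Rightarrow> 'a hypergraph set \<Rightarrow> bool" for t where
  merge: "\<lbrakk>A \<in> P; B \<in> P; A \<noteq> B; e \<in> A; f \<in> B; card (e \<inter> f) \<ge> t\<rbrakk>
    \<Longrightarrow> merge_step t P (insert (A \<union> B) (P - {A, B}))"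

text \<open>The merging process is nondeterministic; for a finite hypergraph it terminates and its
  result does not depend on the order of the merges (\<open>tight_components_ex1\<close> below), so the
  definite description denotes.\<close>

definition tight_components :: "nat \<Rightarrow> 'a hypergraph \<Rightarrow> 'a hypergraph set" where
  "tight_components t H =
    (THE P. (merge_step t)\<^sup>*\<^sup>* ((\<lambda>e. {e}) ` H) P \<and> \<not> (\<exists>Q. merge_step t P Q))"

definition colorings :: "nat \<Rightarrow> 'a hypergraph \<Rightarrow> ('a set \<Rightarrow> nat) set" where
  "colorings r H = H \<rightarrow>\<^sub>E {1..r}"

definition color_class :: "'a hypergraph \<Rightarrow> ('a set \<Rightarrow> nat) \<Rightarrow> nat \<Rightarrow> 'a hypergraph" where
  "color_class H c i = {e \<in> H. c e = i}"

definition M_coloring :: "nat \<Rightarrow> nat \<Rightarrow> nat \<Rightarrow> nat \<Rightarrow> nat \<Rightarrow> (nat set \<Rightarrow> nat) \<Rightarrow> nat" where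
  "M_coloring n r k t s c =
    (let K = complete_hypergraph k {..<n} in
      Max ((\<lambda>i. Max ((\<lambda>C. card (shadow s C)) ` tight_components t (color_class K c i)))
        ` {i \<in> {1..r}. color_class K c i \<noteq> {}}))"

text \<open>Meaningful for \<open>n \<ge> k\<close> and \<open>r \<ge> 1\<close> only: otherwise there is no edge or no coloring.\<close>

definition M :: "nat \<Rightarrow> nat \<Rightarrow> nat \<Rightarrow> nat \<Rightarrow> nat \<Rightarrow> nat" where
  "M n r k t s = Min (M_coloring n r k t s ` colorings r (complete_hypergraph k {..<n}))"


definition tight_adj :: "nat \<Rightarrow> 'a hypergraph \<Rightarrow> ('a set \<times> 'a set) set" where
  "tight_adj t H = {(e, f). e \<in> H \<and> f \<in> H \<and> card (e \<inter> f) \<ge> t}"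

lemma sym_tight_adj_rtrancl: "sym ((tight_adj t H)\<^sup>*)"
  by (intro sym_rtrancl) (auto simp: sym_def tight_adj_def Int_commute)

definition merge_inv :: "nat \<Rightarrow> 'a hypergraph \<Rightarrow> 'a hypergraph set \<Rightarrow> bool" where
  "merge_inv t H P \<longleftrightarrow> finite P \<and> \<Union>P = H \<and> {} \<notin> P \<and>
    (\<forall>A\<in>P. \<forall>B\<in>P. A \<noteq> B \<longrightarrow> A \<inter> B = {}) \<and>
    (\<forall>A\<in>P. \<forall>e\<in>A. \<forall>f\<in>A. (e, f) \<in> (tight_adj t H)\<^sup>*)"

lemma merge_inv_step:
  assumes "merge_step t P Q" "merge_inv t H P"
  shows "merge_inv t H Q" "card Q < card P"
proof -
  let ?R = "(tight_adj t H)\<^sup>*"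
  from assms(1) obtain A B e f where AB: "A \<in> P" "B \<in> P" "A \<noteq> B" "e \<in> A" "f \<in> B"
    "card (e \<inter> f) \<ge> t" and Q: "Q = insert (A \<union> B) (P - {A, B})"
    by (rule merge_step.cases) blast
  have fin: "finite P" and un: "\<Union>P = H" and ne: "{} \<notin> P"
    and disj: "\<And>A B. A \<in> P \<Longrightarrow> B \<in> P \<Longrightarrow> A \<noteq> B \<Longrightarrow> A \<inter> B = {}"
    and R: "\<And>A e f. A \<in> P \<Longrightarrow> e \<in> A \<Longrightarrow> f \<in> A \<Longrightarrow> (e, f) \<in> ?R"
    using assms(2) unfolding merge_inv_def by blast+
  have ef: "(e, f) \<in> ?R" using AB un by (auto simp: tight_adj_def)
  have AtoB: "(x, y) \<in> ?R" if "x \<in> A" "y \<in> B" for x y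
    using R[OF AB(1) that(1) AB(4)] ef R[OF AB(2) AB(5) that(2)] by (meson rtrancl_trans)
  have BtoA: "(y, x) \<in> ?R" if "x \<in> A" "y \<in> B" for x y
    using AtoB[OF that] sym_tight_adj_rtrancl[of t H] by (auto dest: symD)
  have 1: "\<Union>Q = H" unfolding Q un[symmetric] using AB(1,2) by auto
  have finQ: "finite Q" unfolding Q using fin by simp
  have neQ: "{} \<notin> Q" unfolding Q using ne AB(4) by auto
  have 2: "\<forall>C\<in>Q. \<forall>e\<in>C. \<forall>f\<in>C. (e, f) \<in> ?R"
  proof (intro ballI)
    fix C x y assume "C \<in> Q" "x \<in> C" "y \<in> C"
    then consider "C = A \<union> B" | "C \<in> P" unfolding Q by blast
    then show "(x, y) \<in> ?R"
    proof cases
      case 1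
      then show ?thesis
        using \<open>x \<in> C\<close> \<open>y \<in> C\<close> R[OF AB(1)] R[OF AB(2)] AtoB BtoA by blast
    next
      case 2
      then show ?thesis using \<open>x \<in> C\<close> \<open>y \<in> C\<close> R by blast
    qed
  qed
  have 3: "\<forall>C\<in>Q. \<forall>D\<in>Q. C \<noteq> D \<longrightarrow> C \<inter> D = {}"
  proof (intro ballI impI)
    fix C D assume CD: "C \<in> Q" "D \<in> Q" "C \<noteq> D"
    have AB': "E \<inter> (A \<union> B) = {}" "(A \<union> B) \<inter> E = {}" if "E \<in> P - {A, B}" for E
      using disj[OF AB(1), of E] disj[OF AB(2), of E] that by auto
    show "C \<inter> D = {}"
      using CD AB' disj[of C D] unfolding Q by (metis Diff_iff insert_iff)
  qed
  show "merge_inv t H Q"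
    unfolding merge_inv_def using 1 2 3 finQ neQ by (intro conjI)
  have "card {A, B} \<le> card P" using fin AB by (intro card_mono) auto
  moreover have "card (P - {A, B}) = card P - card {A, B}"
    using fin AB by (intro card_Diff_subset) auto
  moreover have "card Q \<le> Suc (card (P - {A, B}))"
    unfolding Q by (simp add: fin card_insert_if)
  ultimately show "card Q < card P" using AB(3) by simp
qed

lemma merge_inv_steps:
  "(merge_step t)\<^sup>*\<^sup>* P Q \<Longrightarrow> merge_inv t H P \<Longrightarrow> merge_inv t H Q"
  by (induction rule: rtranclp_induct) (blast intro: merge_inv_step(1))+

lemma merge_inv_init: "finite H \<Longrightarrow> merge_inv t H ((\<lambda>e. {e}) ` H)"
  by (auto simp: merge_inv_def)

lemma merge_terminates:
  "merge_inv t H P \<Longrightarrow> \<exists>Q. (merge_step t)\<^sup>*\<^sup>* P Q \<and> \<not> (\<exists>Q'. merge_step t Q Q')"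
proof (induction "card P" arbitrary: P rule: less_induct)
  case less
  then show ?case
  proof (cases "\<exists>Q. merge_step t P Q")
    case True
    then obtain Q where Q: "merge_step t P Q" by blast
    show ?thesis
      using less.hyps[OF merge_inv_step(2)[OF Q less.prems] merge_inv_step(1)[OF Q less.prems]]
        converse_rtranclp_into_rtranclp[of "merge_step t", OF Q] by blast
  qed blast
qed

lemma merge_final:
  assumes inv: "merge_inv t H P" and fin: "\<not> (\<exists>Q. merge_step t P Q)"
  shows "P = H // (tight_adj t H)\<^sup>*"
proof -
  let ?R = "(tight_adj t H)\<^sup>*"
  have closed: "f \<in> A" if "A \<in> P" "e \<in> A" "(e, f) \<in> ?R" for A e f
    using that(3)
  proof (induction rule: rtrancl_induct)
    case (step x y)
    then have "y \<in> \<Union>P" using inv by (auto simp: merge_inv_def tight_adj_def)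
    then obtain B where "B \<in> P" "y \<in> B" by blast
    then show ?case using fin merge[of A P B x y t] that(1) step
      by (cases "A = B") (auto simp: tight_adj_def)
  qed (use that in auto)
  have cls: "A = ?R `` {e}" if "A \<in> P" "e \<in> A" for A e
  proof
    have "(e, f) \<in> ?R" if "f \<in> A" for f
      using inv \<open>A \<in> P\<close> \<open>e \<in> A\<close> that unfolding merge_inv_def by blast
    then show "A \<subseteq> ?R `` {e}" by blast
    show "?R `` {e} \<subseteq> A" using closed[OF that] by blast
  qed
  show ?thesis
  proof (intro set_eqI iffI)
    fix A assume A: "A \<in> P"
    then have "A \<noteq> {}" "A \<subseteq> H" using inv unfolding merge_inv_def by blast+
    then obtain e where "e \<in> A" "e \<in> H" by blast
    then show "A \<in> H // ?R" using cls[OF A] quotientI by metis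
  next
    fix A assume "A \<in> H // ?R"
    then obtain e where "e \<in> H" "A = ?R `` {e}" by (auto simp: quotient_def)
    moreover from this obtain B where "B \<in> P" "e \<in> B" using inv by (auto simp: merge_inv_def)
    ultimately show "A \<in> P" using cls[of B e] by simp
  qed
qed

lemma tight_components_ex1:
  assumes "finite H"
  shows "\<exists>!P. (merge_step t)\<^sup>*\<^sup>* ((\<lambda>e. {e}) ` H) P \<and> \<not> (\<exists>Q. merge_step t P Q)"
proof (rule ex_ex1I)
  show "\<exists>P. (merge_step t)\<^sup>*\<^sup>* ((\<lambda>e. {e}) ` H) P \<and> \<not> (\<exists>Q. merge_step t P Q)"
    using merge_terminates[OF merge_inv_init[OF assms]] .
next
  fix P Q
  assume P: "(merge_step t)\<^sup>*\<^sup>* ((\<lambda>e. {e}) ` H) P \<and> \<not> (\<exists>Q. merge_step t P Q)"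
    and Q: "(merge_step t)\<^sup>*\<^sup>* ((\<lambda>e. {e}) ` H) Q \<and> \<not> (\<exists>R. merge_step t Q R)"
  note final = merge_final[OF merge_inv_steps[OF conjunct1 merge_inv_init[OF assms]] conjunct2]
  show "P = Q"
    using final[OF P P] final[OF Q Q] by simp
qed

lemma tight_components_eq_quotient:
  assumes "finite H"
  shows "tight_components t H = H // (tight_adj t H)\<^sup>*"
proof -
  note ex1 = theI'[OF tight_components_ex1[OF assms, of t]]
  show ?thesis
    unfolding tight_components_def
    by (rule merge_final[OF merge_inv_steps[OF conjunct1[OF ex1] merge_inv_init[OF assms]]
          conjunct2[OF ex1]])
qed

end

theory Submission
  imports Defs "HOL-Library.Disjoint_Sets"
begin

text \<open>
  Write \<open>x n\<close> for the density \<open>M n r k t s / (n choose s)\<close>. The idea is that a good coloring for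
  a large \<open>n\<close> yields an almost equally good coloring for a smaller \<open>m\<close>, by restriction to a random
  set of \<open>m\<close> vertices. Restriction only splits monochromatic tight components, so each shadow of
  a component in the restricted coloring lies in the trace of the shadow of a component in the
  original coloring. On average the trace has about the density of that shadow.

  The difficulty is that one sample must be good for all components at the same time: they may be
  numerous, and their \<open>s\<close>-shadows can overlap when \<open>s < t\<close>. But there are at most
  \<^term>\<open>n choose k\<close> components, whereas the density of a trace is sharply concentrated, since
  moving one sampled vertex changes it by at most \<open>s / m\<close>. An exponential moment bound therefore
  leaves an error of order \<open>ln n / sqrt m\<close>, which is small as long as \<open>n\<close> is polynomial in \<open>m\<close>.

  To get independent choices, the sample takes one vertex from each of \<open>m\<close> disjoint blocks of
  length \<open>q = n div m\<close>. Such a sample sees only the \<open>s\<close>-sets that meet every block at most once,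
  and these are all but a fraction of order \<open>1 / m\<close> of the \<open>s\<close>-sets. The existence of a good
  sample is \<open>transversal_sampling\<close>; its consequence \<open>M_density_le_add_error\<close> says that
  \<open>x m \<le> x n + D * m powr (- 1/4)\<close> whenever \<open>m\<^sup>2 \<le> n \<le> m ^ 4\<close>.

  Repeated squaring of \<open>m\<close> removes the upper bound on \<open>n\<close> at the cost of a factor \<open>2\<close> in the
  error (\<open>chain_squares\<close>). A bounded sequence that satisfies such an almost-monotonicity with
  vanishing errors converges (\<open>convergent_if_almost_mono\<close>).
\<close>

section \<open>Exponential moments on finite products\<close>

lemma exp_le_quadratic:
  fixes x :: real
  assumes "\<bar>x\<bar> \<le> 1"
  shows "exp x \<le> 1 + x + x\<^sup>2"
proof (cases "x \<ge> 0")
  case True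
  then show ?thesis using exp_bound assms by simp
next
  case False
  define y where "y = - x"
  have y: "y > 0" using False by (simp add: y_def)
  have "1 \<le> 1 + y^2/2 + y^3/2 + y^4/2" using y by simp
  also have "\<dots> = (1 - y + y\<^sup>2) * (1 + y + y\<^sup>2 / 2)"
    by (simp add: field_simps power2_eq_square power3_eq_cube power4_eq_xxxx)
  also have "\<dots> \<le> (1 - y + y\<^sup>2) * exp y"
  proof (rule mult_left_mono)
    show "1 + y + y\<^sup>2 / 2 \<le> exp y" using exp_lower_Taylor_quadratic y by simp
    have "1 - y + y\<^sup>2 = (1/2 - y)\<^sup>2 + 3/4" by (simp add: power2_eq_square field_simps)
    then show "0 \<le> 1 - y + y\<^sup>2" by simp
  qed
  finally have "exp (- y) \<le> 1 - y + y\<^sup>2" by (simp add: exp_minus field_simps)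
  then show ?thesis by (simp add: y_def)
qed

text \<open>Around the mean, the linear term of the quadratic bound on \<^const>\<open>exp\<close> averages to zero.\<close>

lemma sum_exp_le_exp_mean:
  fixes y :: "'a \<Rightarrow> real" and c :: real
  assumes fin: "finite A" and ne: "A \<noteq> {}" and c: "c \<le> 1"
    and osc: "\<And>a b. a \<in> A \<Longrightarrow> b \<in> A \<Longrightarrow> \<bar>y a - y b\<bar> \<le> c"
  shows "(\<Sum>a\<in>A. exp (y a)) \<le> card A * exp ((\<Sum>a\<in>A. y a) / card A + c\<^sup>2)"
proof -
  define N where "N = real (card A)"
  define \<mu> where "\<mu> = (\<Sum>a\<in>A. y a) / N"
  have N: "N > 0" using fin ne by (simp add: N_def card_gt_0_iff)
  have dev: "\<bar>y a - \<mu>\<bar> \<le> c" if "a \<in> A" for a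
  proof -
    have "y a - \<mu> = (\<Sum>b\<in>A. y a - y b) / N"
      using N by (simp add: \<mu>_def sum_subtractf N_def field_simps)
    then have "\<bar>y a - \<mu>\<bar> = \<bar>\<Sum>b\<in>A. y a - y b\<bar> / N" using N by simp
    also have "\<bar>\<Sum>b\<in>A. y a - y b\<bar> \<le> (\<Sum>b\<in>A. c)"
      by (rule order_trans[OF sum_abs sum_mono]) (use osc that in auto)
    finally show ?thesis using N by (simp add: N_def divide_right_mono)
  qed
  have "(\<Sum>a\<in>A. exp (y a - \<mu>)) \<le> (\<Sum>a\<in>A. (1 + c\<^sup>2) + (y a - \<mu>))"
  proof (rule sum_mono)
    fix a assume a: "a \<in> A"
    have "(y a - \<mu>)\<^sup>2 \<le> c\<^sup>2" using dev[OF a] by (metis abs_ge_zero power2_abs power_mono)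
    then show "exp (y a - \<mu>) \<le> (1 + c\<^sup>2) + (y a - \<mu>)"
      using exp_le_quadratic[of "y a - \<mu>"] dev[OF a] c by linarith
  qed
  also have "\<dots> = N * (1 + c\<^sup>2) + ((\<Sum>a\<in>A. y a) - N * \<mu>)"
    by (simp add: sum.distrib sum_subtractf N_def)
  also have "\<dots> = N * (1 + c\<^sup>2)" using N by (simp add: \<mu>_def)
  also have "\<dots> \<le> N * exp (c\<^sup>2)" using N by (intro mult_left_mono) auto
  finally have "exp \<mu> * (\<Sum>a\<in>A. exp (y a - \<mu>)) \<le> exp \<mu> * (N * exp (c\<^sup>2))"
    by (rule mult_left_mono) simp
  then show ?thesis
    by (simp add: sum_distrib_left flip: exp_add) (simp add: exp_add \<mu>_def N_def mult_ac)
qed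

lemma sum_PiE_insert:
  fixes f :: "('i \<Rightarrow> 'a) \<Rightarrow> 'b::comm_monoid_add"
  assumes "i \<notin> I"
  shows "(\<Sum>x\<in>PiE (insert i I) A. f x) = (\<Sum>x\<in>PiE I A. \<Sum>a\<in>A i. f (x(i := a)))"
proof -
  have "(\<Sum>x\<in>PiE (insert i I) A. f x) = (\<Sum>(a, x)\<in>A i \<times> PiE I A. f (x(i := a)))"
    unfolding PiE_insert_eq
    by (subst sum.reindex[OF inj_combinator[OF assms]]) (simp add: case_prod_unfold)
  also have "\<dots> = (\<Sum>x\<in>PiE I A. \<Sum>a\<in>A i. f (x(i := a)))"
    by (subst sum.swap) (simp add: sum.cartesian_product)
  finally show ?thesis .
qed

text \<open>A bounded differences inequality of McDiarmid type, in exponential form, for the uniform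
  distribution on a finite product. Averaging over one coordinate costs a factor
  \<open>exp (c\<^sup>2)\<close>, and the averaged function still changes by at most \<open>c\<close> in every other
  coordinate, which drives the induction.\<close>

lemma sum_exp_PiE_le:
  fixes f :: "('i \<Rightarrow> 'a) \<Rightarrow> real" and c :: real
  assumes "finite I" and q: "q > 0" and B: "\<And>i. i \<in> I \<Longrightarrow> card (B i) = q" and c: "c \<le> 1"
    and osc: "\<And>x i a b. x \<in> PiE I B \<Longrightarrow> i \<in> I \<Longrightarrow> a \<in> B i \<Longrightarrow> b \<in> B i \<Longrightarrow>
      \<bar>f (x(i := a)) - f (x(i := b))\<bar> \<le> c"
  shows "(\<Sum>x\<in>PiE I B. exp (f x))
    \<le> real q ^ card I * exp ((\<Sum>x\<in>PiE I B. f x) / real q ^ card I + card I * c\<^sup>2)"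
  using assms(1) B osc
proof (induction I arbitrary: f rule: finite_induct)
  case empty
  then show ?case by simp
next
  case (insert i I)
  define g where "g x = (\<Sum>a\<in>B i. f (x(i := a))) / q" for x
  have Bi: "card (B i) = q" using insert.prems(1) by simp
  then have finB: "finite (B i)" "B i \<noteq> {}" using q by (auto intro: card_ge_0_finite)
  have ext: "x(i := a) \<in> PiE (insert i I) B" if "x \<in> PiE I B" "a \<in> B i" for x a
    using that insert.hyps(2) by (auto simp: PiE_def extensional_def)
  have inner: "(\<Sum>a\<in>B i. exp (f (x(i := a)))) \<le> q * exp (g x + c\<^sup>2)" if x: "x \<in> PiE I B" for x
  proof -
    have "\<bar>f (x(i := a)) - f (x(i := b))\<bar> \<le> c" if "a \<in> B i" "b \<in> B i" for a b
      using insert.prems(2)[OF ext[OF x that(1)] insertI1 that] by (simp only: fun_upd_upd)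
    then show ?thesis
      using sum_exp_le_exp_mean[OF finB c, of "\<lambda>a. f (x(i := a))"] Bi by (simp add: g_def)
  qed
  have osc_g: "\<bar>g (x(j := a)) - g (x(j := b))\<bar> \<le> c"
    if x: "x \<in> PiE I B" and j: "j \<in> I" and ab: "a \<in> B j" "b \<in> B j" for x j a b
  proof -
    have ij: "i \<noteq> j" using insert.hyps(2) j by auto
    have "\<bar>\<Sum>d\<in>B i. f (x(j := a, i := d)) - f (x(j := b, i := d))\<bar> \<le> (\<Sum>d\<in>B i. c)"
    proof (rule order_trans[OF sum_abs sum_mono])
      fix d assume d: "d \<in> B i"
      show "\<bar>f (x(j := a, i := d)) - f (x(j := b, i := d))\<bar> \<le> c"
        using insert.prems(2)[OF ext[OF x d], of j a b] j ab
        by (simp only: fun_upd_twist[OF ij[symmetric]] insertI2)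
    qed
    then have "\<bar>(\<Sum>d\<in>B i. f (x(j := a, i := d))) - (\<Sum>d\<in>B i. f (x(j := b, i := d)))\<bar> / q \<le> c"
      using q Bi by (simp add: sum_subtractf divide_le_eq mult.commute)
    then show ?thesis using q by (simp add: g_def flip: diff_divide_distrib)
  qed
  have "(\<Sum>x\<in>PiE (insert i I) B. exp (f x)) \<le> (\<Sum>x\<in>PiE I B. q * exp (g x + c\<^sup>2))"
    unfolding sum_PiE_insert[OF insert.hyps(2)] by (intro sum_mono inner)
  also have "\<dots> = q * exp (c\<^sup>2) * (\<Sum>x\<in>PiE I B. exp (g x))"
    by (simp add: sum_distrib_left exp_add mult_ac)
  also have "\<dots> \<le> q * exp (c\<^sup>2) *
      (real q ^ card I * exp ((\<Sum>x\<in>PiE I B. g x) / real q ^ card I + card I * c\<^sup>2))"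
    by (rule mult_left_mono[OF insert.IH[of g, OF _ osc_g]]) (use insert.prems(1) in auto)
  also have "(\<Sum>x\<in>PiE I B. g x) = (\<Sum>x\<in>PiE (insert i I) B. f x) / q"
    unfolding sum_PiE_insert[OF insert.hyps(2)] g_def by (simp add: sum_divide_distrib)
  finally show ?case
    using insert.hyps q by (simp add: exp_add algebra_simps)
qed

section \<open>Sampling a transversal\<close>

definition trace :: "nat \<Rightarrow> 'i set \<Rightarrow> ('i \<Rightarrow> 'a) \<Rightarrow> 'a set set \<Rightarrow> 'i set set" where
  "trace s I x S = {T. T \<subseteq> I \<and> card T = s \<and> x ` T \<in> S}"

lemma finite_trace: "finite I \<Longrightarrow> finite (trace s I x S)"
  by (rule finite_subset[of _ "Pow I"]) (auto simp: trace_def)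

lemma card_subsets_containing:
  assumes "finite I" "i \<in> I" "s > 0"
  shows "card {T. T \<subseteq> I \<and> card T = s \<and> i \<in> T} = (card I - 1) choose (s - 1)"
proof -
  have "{T. T \<subseteq> I \<and> card T = s \<and> i \<in> T} = insert i ` {T. T \<subseteq> I - {i} \<and> card T = s - 1}"
    (is "?L = ?R")
  proof (intro equalityI subsetI)
    fix T assume "T \<in> ?L"
    then have "T = insert i (T - {i})" "T - {i} \<subseteq> I - {i}" "card (T - {i}) = s - 1"
      using assms finite_subset by auto
    then show "T \<in> ?R" by blast
  next
    fix T assume "T \<in> ?R"
    then obtain T' where "T = insert i T'" "T' \<subseteq> I - {i}" "card T' = s - 1" by auto
    moreover have "finite T'" using \<open>T' \<subseteq> I - {i}\<close> assms(1) finite_subset by blast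
    ultimately show "T \<in> ?L" using assms by (auto simp: card_insert_if)
  qed
  moreover have "inj_on (insert i) {T. T \<subseteq> I - {i} \<and> card T = s - 1}"
    by (auto simp: inj_on_def)
  ultimately show ?thesis
    using assms by (simp add: card_image n_subsets)
qed

text \<open>Moving the image of one index \<open>i\<close> affects only the \<open>s\<close>-sets containing \<open>i\<close>, and these form
  the fraction \<open>s / card I\<close> of all \<open>s\<close>-subsets of \<open>I\<close>.\<close>

lemma card_trace_osc:
  assumes I: "finite I" "i \<in> I" and s: "s > 0"
  shows "\<bar>real (card (trace s I (x(i := a)) S)) - real (card (trace s I (x(i := b)) S))\<bar>
    \<le> s / card I * (card I choose s)"
proof -
  define W where "W = {T. T \<subseteq> I \<and> card T = s \<and> i \<in> T}"
  have finW: "finite W" by (rule finite_subset[of _ "Pow I"]) (use I in \<open>auto simp: W_def\<close>)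
  have le: "card (trace s I (x(i := a)) S) \<le> card (trace s I (x(i := b)) S) + card W" for a b
  proof -
    have "T \<in> trace s I (x(i := b)) S \<union> W" if T: "T \<in> trace s I (x(i := a)) S" for T
    proof (cases "i \<in> T")
      case False
      then have "(x(i := a)) ` T = (x(i := b)) ` T" by (intro image_cong) auto
      then show ?thesis using T by (auto simp: trace_def)
    qed (use T in \<open>auto simp: trace_def W_def\<close>)
    then have "trace s I (x(i := a)) S \<subseteq> trace s I (x(i := b)) S \<union> W" by blast
    then show ?thesis
      by (meson I(1) card_Un_le card_mono finW finite_UnI finite_trace order_trans)
  qed
  have "card I * card W = s * (card I choose s)"
    using times_binomial_minus1_eq[OF s, of "card I"] card_subsets_containing[OF I s]
    by (simp add: W_def)
  moreover have "card I > 0" using I by (auto simp: card_gt_0_iff)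
  ultimately have "real (card W) = s / card I * (card I choose s)"
    by (simp add: field_simps flip: of_nat_mult)
  then show ?thesis using le[of a b] le[of b a] by linarith
qed

text \<open>A double count of the pairs of a transversal \<open>x\<close> and a set \<open>U \<in> S\<close> hit by it. Because
  the blocks are disjoint, \<open>U\<close> determines the set of indices mapped onto it as well as the values of
  \<open>x\<close> there, so \<open>x\<close> is free on the other \<open>card I - s\<close> blocks only.\<close>

lemma sum_card_trace_le:
  assumes I: "finite I" and disj: "disjoint_family_on B I" and q: "q > 0"
    and B: "\<And>i. i \<in> I \<Longrightarrow> card (B i) = q" and S: "finite S"
  shows "(\<Sum>x\<in>PiE I B. card (trace s I x S)) \<le> card S * q ^ (card I - s)"
proof -
  have finB: "finite (B i)" if "i \<in> I" for i
    using B[OF that] q by (auto intro: card_ge_0_finite)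
  have finP: "finite (PiE J B)" if "J \<subseteq> I" for J
    using that I finB by (intro finite_PiE) (auto intro: finite_subset)
  define T where "T U = {i \<in> I. B i \<inter> U \<noteq> {}}" for U
  have T_eq: "J = T U" if "x \<in> PiE I B" "J \<subseteq> I" "x ` J = U" for x J U
  proof (intro equalityI subsetI)
    fix i assume "i \<in> J"
    then have "x i \<in> B i" "x i \<in> U" using that by auto
    then show "i \<in> T U" using \<open>i \<in> J\<close> that(2) by (auto simp: T_def)
  next
    fix i assume "i \<in> T U"
    then have i: "i \<in> I" "B i \<inter> x ` J \<noteq> {}" using that by (auto simp: T_def)
    then obtain j where j: "j \<in> J" "x j \<in> B i" "i \<in> I" by blast
    then have "x j \<in> B j" using that by auto
    then have "i = j" using disj j that(2) by (auto simp: disjoint_family_on_def)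
    then show "i \<in> J" using j by simp
  qed
  define X where "X U = {x \<in> PiE I B. card (T U) = s \<and> x ` T U = U}" for U
  have card_X: "card (X U) \<le> q ^ (card I - s)" for U
  proof (cases "card (T U) = s")
    case True
    have TI: "T U \<subseteq> I" by (auto simp: T_def)
    have "inj_on (\<lambda>x. restrict x (I - T U)) (X U)"
    proof (rule inj_onI)
      fix x y assume x: "x \<in> X U" and y: "y \<in> X U"
        and eq: "restrict x (I - T U) = restrict y (I - T U)"
      show "x = y"
      proof (rule PiE_ext[of _ I B])
        fix i assume i: "i \<in> I"
        show "x i = y i"
        proof (cases "i \<in> T U")
          case True
          then have "x i \<in> y ` T U" using x y by (auto simp: X_def)
          then obtain j where j: "j \<in> T U" "x i = y j" by blast
          have "x i \<in> B i" using x i by (auto simp: X_def)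
          moreover have "y j \<in> B j" using y j(1) TI by (auto simp: X_def)
          ultimately have "i = j" using disj i j TI by (auto simp: disjoint_family_on_def)
          then show ?thesis using j by simp
        next
          case False
          then show ?thesis using i fun_cong[OF eq, of i] by simp
        qed
      qed (use x y in \<open>auto simp: X_def\<close>)
    qed
    then have "card (X U) \<le> card (PiE (I - T U) B)"
      by (rule card_inj_on_le) (auto simp: X_def intro: finP)
    also have "\<dots> = q ^ (card I - s)"
      using I B True TI by (simp add: card_PiE card_Diff_subset finite_subset[OF TI])
    finally show ?thesis .
  qed (simp add: X_def)
  have "card (trace s I x S) \<le> card {U \<in> S. x \<in> X U}" if x: "x \<in> PiE I B" for x
  proof (rule card_inj_on_le[where f = "(`) x"])
    show "inj_on ((`) x) (trace s I x S)"
      by (rule inj_onI) (metis (mono_tags, lifting) T_eq[OF x] mem_Collect_eq trace_def)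
    show "(`) x ` trace s I x S \<subseteq> {U \<in> S. x \<in> X U}"
    proof clarify
      fix J assume "J \<in> trace s I x S"
      then have J: "J \<subseteq> I" "card J = s" "x ` J \<in> S" by (auto simp: trace_def)
      then show "x ` J \<in> S \<and> x \<in> X (x ` J)"
        using T_eq[OF x J(1) refl] x by (auto simp: X_def)
    qed
  qed (use S in simp)
  then have "(\<Sum>x\<in>PiE I B. card (trace s I x S)) \<le> (\<Sum>x\<in>PiE I B. card {U \<in> S. x \<in> X U})"
    by (rule sum_mono)
  also have "\<dots> = (\<Sum>U\<in>S. card {x \<in> PiE I B. x \<in> X U})"
    using finP S by (intro sum_multicount_gen) auto
  also have "\<dots> = (\<Sum>U\<in>S. card (X U))"
    by (intro sum.cong arg_cong[of _ _ card]) (auto simp: X_def)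
  also have "\<dots> \<le> (\<Sum>U\<in>S. q ^ (card I - s))" by (intro sum_mono card_X)
  finally show ?thesis by simp
qed

text \<open>The average of the sum over \<open>F\<close> of exponential moments is small, so some transversal makes
  this sum small and hence each of its terms. The scale \<^term>\<open>sqrt m\<close> for the densities
  balances the two errors: \<open>m\<close> coordinates with differences \<open>s / sqrt m\<close> contribute the
  constant \<open>s\<^sup>2\<close> to the exponent, and the hypothesis \<open>s\<^sup>2 \<le> m\<close> keeps these differences
  at most \<open>1\<close>.\<close>

lemma transversal_sampling:
  fixes B :: "'i \<Rightarrow> 'a set" and F :: "'a set set set"
  assumes I: "finite I" and m: "card I = m" and disj: "disjoint_family_on B I" and q: "q > 0"
    and B: "\<And>i. i \<in> I \<Longrightarrow> card (B i) = q"
    and F: "finite F" "F \<noteq> {}" "\<And>S. S \<in> F \<Longrightarrow> finite S"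
    and s: "s > 0" "s\<^sup>2 \<le> m"
  shows "\<exists>x\<in>PiE I B. \<forall>S\<in>F.
    card (trace s I x S) \<le> card S / real q ^ s + (m choose s) * ((ln (card F) + (real s)\<^sup>2) / sqrt m)"
proof -
  have sm: "s \<le> m" using s by (metis le_square order_trans power2_eq_square)
  have m0: "m > 0" using s sm by simp
  define b where "b = real (m choose s)"
  have b: "b > 0" using sm by (simp add: b_def)
  define h where "h S x = sqrt m / b * card (trace s I x S)" for S :: "'a set set" and x
  define \<mu> where "\<mu> S = sqrt m / b * (card S / real q ^ s)" for S :: "'a set set"
  define c where "c = s / sqrt m"
  have "real s \<le> sqrt m"
    using s(2) by (metis of_nat_le_iff of_nat_power real_le_rsqrt)
  then have c1: "c \<le> 1" using m0 by (simp add: c_def)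
  have finB: "finite (B i) \<and> B i \<noteq> {}" if "i \<in> I" for i
    using B[OF that] q by (auto intro: card_ge_0_finite)
  have card_P: "card (PiE I B) = q ^ m" using I B m by (simp add: card_PiE)
  have finP: "finite (PiE I B)" using I finB by (intro finite_PiE) auto
  have moment: "(\<Sum>x\<in>PiE I B. exp (h S x - \<mu> S)) \<le> real q ^ m * exp ((real s)\<^sup>2)" if S: "S \<in> F" for S
  proof -
    have osc: "\<bar>h S (x(i := a)) - h S (x(i := d))\<bar> \<le> c" if "i \<in> I" for x i a d
    proof -
      have "h S (x(i := a)) - h S (x(i := d)) = sqrt m / b *
          (real (card (trace s I (x(i := a)) S)) - real (card (trace s I (x(i := d)) S)))"
        by (simp only: h_def right_diff_distrib)
      then have "\<bar>h S (x(i := a)) - h S (x(i := d))\<bar> = sqrt m / b *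
          \<bar>real (card (trace s I (x(i := a)) S)) - real (card (trace s I (x(i := d)) S))\<bar>"
        using b by (simp add: abs_mult)
      also have "\<dots> \<le> sqrt m / b * (s / m * b)"
        using card_trace_osc[OF I that s(1)] b m
        by (intro mult_left_mono) (auto simp: b_def)
      also have "\<dots> = c"
        using b m0 by (simp add: c_def field_simps flip: power2_eq_square)
      finally show ?thesis .
    qed
    have "real (\<Sum>x\<in>PiE I B. card (trace s I x S)) \<le> real (card S * q ^ (m - s))"
      using sum_card_trace_le[OF I disj q B F(3)[OF S], of s] m by (simp only: of_nat_le_iff)
    also have "\<dots> = real q ^ m * (card S / real q ^ s)"
      using q power_add[of "real q" "m - s" s] sm by simp
    finally have "sqrt m / b * real (\<Sum>x\<in>PiE I B. card (trace s I x S))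
        \<le> sqrt m / b * (real q ^ m * (card S / real q ^ s))"
      by (rule mult_left_mono) (use b in simp)
    also have "sqrt m / b * real (\<Sum>x\<in>PiE I B. card (trace s I x S)) = (\<Sum>x\<in>PiE I B. h S x)"
      by (simp only: h_def of_nat_sum sum_distrib_left)
    also have "sqrt m / b * (real q ^ m * (card S / real q ^ s)) = real q ^ m * \<mu> S"
      by (simp add: \<mu>_def)
    finally have "(\<Sum>x\<in>PiE I B. h S x) \<le> real q ^ m * \<mu> S" .
    then have mean: "(\<Sum>x\<in>PiE I B. h S x) / real q ^ m \<le> \<mu> S"
      using q by (simp add: field_simps)
    have "(\<Sum>x\<in>PiE I B. exp (h S x))
        \<le> real q ^ m * exp ((\<Sum>x\<in>PiE I B. h S x) / real q ^ m + m * c\<^sup>2)"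
      using sum_exp_PiE_le[where f = "h S", OF I q B c1 osc] m by simp
    also have "\<dots> \<le> real q ^ m * exp (\<mu> S + (real s)\<^sup>2)"
      using mean m0 by (intro mult_left_mono) (auto simp: c_def power_divide)
    also have "\<dots> = real q ^ m * exp ((real s)\<^sup>2) * exp (\<mu> S)"
      by (simp add: exp_add)
    finally show ?thesis
      by (simp add: exp_diff divide_le_eq flip: sum_divide_distrib)
  qed
  have "\<exists>x\<in>PiE I B. (\<Sum>S\<in>F. exp (h S x - \<mu> S)) \<le> card F * exp ((real s)\<^sup>2)"
  proof (rule ccontr)
    assume "\<not> ?thesis"
    then have "(\<Sum>x\<in>PiE I B. card F * exp ((real s)\<^sup>2)) < (\<Sum>x\<in>PiE I B. \<Sum>S\<in>F. exp (h S x - \<mu> S))"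
      using finP finB by (intro sum_strict_mono) (auto simp: PiE_eq_empty_iff not_le)
    also have "\<dots> = (\<Sum>S\<in>F. \<Sum>x\<in>PiE I B. exp (h S x - \<mu> S))" by (rule sum.swap)
    also have "\<dots> \<le> (\<Sum>S\<in>F. real q ^ m * exp ((real s)\<^sup>2))" by (intro sum_mono moment)
    finally show False by (simp add: card_P mult_ac)
  qed
  then obtain x where x: "x \<in> PiE I B" "(\<Sum>S\<in>F. exp (h S x - \<mu> S)) \<le> card F * exp ((real s)\<^sup>2)"
    by blast
  have "card (trace s I x S) \<le> card S / real q ^ s + b * ((ln (card F) + (real s)\<^sup>2) / sqrt m)"
    if S: "S \<in> F" for S
  proof -
    have "exp (h S x - \<mu> S) \<le> (\<Sum>S\<in>F. exp (h S x - \<mu> S))"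
      using F S by (intro member_le_sum) auto
    also have "\<dots> \<le> exp (ln (card F) + (real s)\<^sup>2)"
      using x(2) F by (simp add: exp_add card_gt_0_iff)
    finally have "h S x - \<mu> S \<le> ln (card F) + (real s)\<^sup>2" by simp
    then have "sqrt m / b * (card (trace s I x S) - card S / real q ^ s) \<le> ln (card F) + (real s)\<^sup>2"
      by (simp add: h_def \<mu>_def right_diff_distrib)
    then show ?thesis using b m0 by (simp add: field_simps)
  qed
  then show ?thesis using x(1) unfolding b_def by blast
qed

section \<open>Pulling a coloring back along an injection\<close>

text \<open>Indexing the monochromatic tight components by their edges turns the nested maximum in the
  definition of \<^const>\<open>M_coloring\<close> into one maximum over the edges of the complete hypergraph. It
  also bounds the number of components by the number of edges, which is the only bound on that
  number that the sampling argument uses.\<close>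

definition mono_component ::
    "nat \<Rightarrow> 'a hypergraph \<Rightarrow> ('a set \<Rightarrow> nat) \<Rightarrow> 'a set \<Rightarrow> 'a hypergraph" where
  "mono_component t K c e = (tight_adj t (color_class K c (c e)))\<^sup>* `` {e}"

lemma finite_complete_hypergraph: "finite V \<Longrightarrow> finite (complete_hypergraph k V)"
  by (simp add: complete_hypergraph_def)

lemma card_complete_hypergraph: "finite V \<Longrightarrow> card (complete_hypergraph k V) = card V choose k"
  by (simp add: complete_hypergraph_def n_subsets)

lemma mono_component_subset:
  assumes "e \<in> K"
  shows "mono_component t K c e \<subseteq> K"
proof
  fix f assume "f \<in> mono_component t K c e"
  then have "(e, f) \<in> (tight_adj t (color_class K c (c e)))\<^sup>*" by (simp add: mono_component_def)
  then show "f \<in> K"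
    by (induction rule: rtrancl_induct) (use assms in \<open>auto simp: tight_adj_def color_class_def\<close>)
qed

lemma shadow_subset_complete:
  assumes "C \<subseteq> complete_hypergraph k V"
  shows "shadow s C \<subseteq> complete_hypergraph s V"
  using assms by (fastforce simp: shadow_def complete_hypergraph_def)

lemma M_coloring_eq_Max:
  assumes "k \<le> n" and c: "c \<in> colorings r (complete_hypergraph k {..<n})"
  defines "K \<equiv> complete_hypergraph k {..<n}"
  shows "M_coloring n r k t s c = Max ((\<lambda>e. card (shadow s (mono_component t K c e))) ` K)"
proof -
  define v where "v e = card (shadow s (mono_component t K c e))" for e
  define I where "I = {i \<in> {1..r}. color_class K c i \<noteq> {}}"
  have finK: "finite K" by (simp add: K_def finite_complete_hypergraph)
  have fincc: "finite (color_class K c i)" for i using finK by (simp add: color_class_def)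
  have finI: "finite I" by (simp add: I_def)
  have "K \<noteq> {}" using assms(1) finK card_complete_hypergraph[of "{..<n}" k]
    by (auto simp: K_def dest: arg_cong[of _ _ card])
  have inI: "c e \<in> I" "e \<in> color_class K c (c e)" if "e \<in> K" for e
    using that c by (auto simp: I_def color_class_def colorings_def K_def)
  then have neI: "I \<noteq> {}" using \<open>K \<noteq> {}\<close> by blast
  have "(\<lambda>C. card (shadow s C)) ` tight_components t (color_class K c i) = v ` color_class K c i" for i
    unfolding tight_components_eq_quotient[OF fincc] v_def mono_component_def quotient_def
    by (force simp: color_class_def)
  then have "M_coloring n r k t s c = Max ((\<lambda>i. Max (v ` color_class K c i)) ` I)"
    by (simp add: M_coloring_def Let_def K_def[symmetric] I_def)
  also have "\<dots> = Max (v ` K)"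
  proof (rule antisym)
    show "Max ((\<lambda>i. Max (v ` color_class K c i)) ` I) \<le> Max (v ` K)"
    proof (rule Max.boundedI)
      fix y assume "y \<in> (\<lambda>i. Max (v ` color_class K c i)) ` I"
      then obtain i where "i \<in> I" "y = Max (v ` color_class K c i)" by blast
      then show "y \<le> Max (v ` K)"
        using finK by (auto simp: I_def color_class_def intro!: Max_mono)
    qed (use finI neI in auto)
    show "Max (v ` K) \<le> Max ((\<lambda>i. Max (v ` color_class K c i)) ` I)"
    proof (rule Max.boundedI)
      fix y assume "y \<in> v ` K"
      then obtain e where e: "e \<in> K" "y = v e" by blast
      have "y \<le> Max (v ` color_class K c (c e))"
        using e inI fincc by (intro Max_ge) auto
      also have "\<dots> \<le> Max ((\<lambda>i. Max (v ` color_class K c i)) ` I)"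
        using e inI finI by (intro Max_ge) auto
      finally show "y \<le> Max ((\<lambda>i. Max (v ` color_class K c i)) ` I)" .
    qed (use finK \<open>K \<noteq> {}\<close> in auto)
  qed
  finally show ?thesis by (simp add: v_def)
qed

lemma finite_colorings: "finite H \<Longrightarrow> finite (colorings r H)"
  by (simp add: colorings_def finite_PiE)

lemma obtain_optimal_coloring:
  assumes "r > 0"
  obtains c where "c \<in> colorings r (complete_hypergraph k {..<n})"
    "M n r k t s = M_coloring n r k t s c"
proof -
  have "colorings r (complete_hypergraph k {..<n}) \<noteq> {}"
    using assms by (auto simp: colorings_def PiE_eq_empty_iff)
  then have "M n r k t s \<in> M_coloring n r k t s ` colorings r (complete_hypergraph k {..<n})"
    unfolding M_def by (intro Min_in) (auto simp: finite_colorings finite_complete_hypergraph)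
  then show ?thesis using that by blast
qed

lemma M_le_M_coloring:
  "c \<in> colorings r (complete_hypergraph k {..<n}) \<Longrightarrow> M n r k t s \<le> M_coloring n r k t s c"
  unfolding M_def by (intro Min_le) (auto simp: finite_colorings finite_complete_hypergraph)

lemma M_coloring_le_iff:
  assumes "k \<le> n" "c \<in> colorings r (complete_hypergraph k {..<n})"
  shows "M_coloring n r k t s c \<le> b \<longleftrightarrow> (\<forall>e\<in>complete_hypergraph k {..<n}.
    card (shadow s (mono_component t (complete_hypergraph k {..<n}) c e)) \<le> b)"
proof -
  have "card (complete_hypergraph k {..<n}) > 0"
    using assms(1) by (simp add: card_complete_hypergraph)
  then show ?thesis
    unfolding M_coloring_eq_Max[OF assms] by (subst Max_le_iff) (auto simp: card_gt_0_iff)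
qed

lemma M_le_binomial:
  assumes "r > 0" "k \<le> n"
  shows "M n r k t s \<le> n choose s"
proof -
  obtain c where c: "c \<in> colorings r (complete_hypergraph k {..<n})"
    "M n r k t s = M_coloring n r k t s c"
    using obtain_optimal_coloring[OF assms(1)] .
  have "card (shadow s (mono_component t (complete_hypergraph k {..<n}) c e)) \<le> n choose s"
    if "e \<in> complete_hypergraph k {..<n}" for e
    using card_mono[OF finite_complete_hypergraph
        shadow_subset_complete[OF mono_component_subset[OF that]], of s t c]
      card_complete_hypergraph[of "{..<n}" s]
    by simp
  then show ?thesis using c M_coloring_le_iff[OF assms(2) c(1)] by simp
qed

text \<open>An injection preserves the sizes of intersections of edges, so it maps tight paths of the
  pulled back coloring to tight paths of the original one. Restricting to a subset of the vertices
  can split a component, but never joins two of them.\<close>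

lemma shadow_pullback_subset_trace:
  fixes x :: "'i \<Rightarrow> 'a"
  assumes inj: "inj_on x I" and I: "finite I" and xV: "x ` I \<subseteq> V"
    and c': "\<And>e. e \<in> complete_hypergraph k I \<Longrightarrow> c' e = c (x ` e)"
    and e: "e \<in> complete_hypergraph k I"
  shows "shadow s (mono_component t (complete_hypergraph k I) c' e)
    \<subseteq> trace s I x (shadow s (mono_component t (complete_hypergraph k V) c (x ` e)))"
proof
  have edge: "x ` f \<in> complete_hypergraph k V" if "f \<in> complete_hypergraph k I" for f
    using that xV card_image[OF inj_on_subset[OF inj]] by (auto simp: complete_hypergraph_def)
  have path: "(x ` e, x ` f) \<in> (tight_adj t (color_class (complete_hypergraph k V) c (c (x ` e))))\<^sup>*"
    if "(e, f) \<in> (tight_adj t (color_class (complete_hypergraph k I) c' (c' e)))\<^sup>*" for f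
    using that
  proof (induction rule: rtrancl_induct)
    case (step f g)
    then have fg: "f \<in> complete_hypergraph k I" "g \<in> complete_hypergraph k I"
      "c' f = c' e" "c' g = c' e" "t \<le> card (f \<inter> g)"
      by (auto simp: tight_adj_def color_class_def)
    then have sub: "f \<subseteq> I" "g \<subseteq> I" by (auto simp: complete_hypergraph_def)
    have "card (x ` f \<inter> x ` g) = card (f \<inter> g)"
      using sub card_image[OF inj_on_subset[OF inj, of "f \<inter> g"]]
      by (simp flip: inj_on_image_Int[OF inj sub]) blast
    then have "(x ` f, x ` g) \<in> tight_adj t (color_class (complete_hypergraph k V) c (c (x ` e)))"
      using fg edge c'[OF e] c' by (simp add: tight_adj_def color_class_def)
    then show ?case using step.IH by simp
  qed simp
  fix T assume "T \<in> shadow s (mono_component t (complete_hypergraph k I) c' e)"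
  then obtain f where T: "card T = s" "T \<subseteq> f"
    and f: "f \<in> mono_component t (complete_hypergraph k I) c' e"
    by (auto simp: shadow_def)
  have "f \<subseteq> I" using mono_component_subset[OF e, of t c'] f by (auto simp: complete_hypergraph_def)
  then have TI: "T \<subseteq> I" using T by blast
  have "card (x ` T) = s" using T(1) card_image[OF inj_on_subset[OF inj TI]] by simp
  moreover have "x ` f \<in> mono_component t (complete_hypergraph k V) c (x ` e)"
    using path f by (simp add: mono_component_def)
  ultimately show "T \<in> trace s I x (shadow s (mono_component t (complete_hypergraph k V) c (x ` e)))"
    using T TI by (auto simp: trace_def shadow_def)
qed

section \<open>Comparing two sizes\<close>

text \<open>The number of \<open>s\<close>-sets meeting each of \<open>m\<close> blocks of size \<open>q\<close> at most once is
  \<open>q ^ s * (m choose s)\<close>. Almost all \<open>s\<close>-subsets of an \<open>n\<close>-set are of this kind when \<open>n\<close>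
  is close to \<open>q * m\<close>: factor by factor, the quotient of the two counts is at least
  \<open>(m - s) / (m + 1)\<close>, and Bernoulli's inequality bounds the power.\<close>

lemma block_binomial_bounds:
  fixes m n q s :: nat
  assumes s: "s \<le> m" and m: "m > 0" and q: "m \<le> q" "q * m \<le> n" "n \<le> q * (m + 1)"
  shows "real q ^ s * (m choose s) \<le> n choose s"
    and "(1 - real s * (real s + 1) / (real m + 1)) * (n choose s) \<le> real q ^ s * (m choose s)"
proof -
  have mn: "m \<le> n" using q m by (metis dual_order.trans le_square mult_le_mono1)
  have sn: "s \<le> n" using s mn by simp
  have qm: "real q ^ s * (m choose s) = (\<Prod>i = 0..<s. real q * (m - i) / (s - i))"
    using s by (simp add: binomial_altdef_of_nat prod_dividef prod.distrib)
  show "real q ^ s * (m choose s) \<le> n choose s"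
    unfolding qm binomial_altdef_of_nat[OF sn]
  proof (intro prod_mono conjI divide_right_mono)
    fix i assume "i \<in> {0..<s}"
    have "q * (m - i) \<le> q * m - i"
      using m q by (cases "q = 0") (auto simp: diff_mult_distrib2 intro: diff_le_mono2)
    then show "real q * (m - i) \<le> (n - i)"
      using q(2) by (metis diff_le_mono of_nat_le_iff of_nat_mult order_trans)
  qed auto
  define u where "u = (real m - s) / (real m + 1)"
  have u: "u \<ge> 0" using s by (simp add: u_def)
  have "1 + real s * (u - 1) \<le> (1 + (u - 1)) ^ s"
    using u by (intro Bernoulli_inequality) simp
  moreover have "real s * (u - 1) = - (real s * (real s + 1) / (real m + 1))"
    by (simp add: u_def field_simps)
  ultimately have "(1 - real s * (real s + 1) / (real m + 1)) * (n choose s) \<le> u ^ s * (n choose s)"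
    by (intro mult_right_mono) auto
  also have "\<dots> = (\<Prod>i = 0..<s. u * (n - i) / (s - i))"
    using sn by (simp add: binomial_altdef_of_nat prod_dividef prod.distrib)
  also have "\<dots> \<le> real q ^ s * (m choose s)"
    unfolding qm
  proof (intro prod_mono conjI divide_right_mono)
    fix i assume i: "i \<in> {0..<s}"
    have "(m - s) * (n - i) \<le> (m - i) * (q * (m + 1))"
      using i q(3) by (intro mult_le_mono) auto
    then have "real ((m - s) * (n - i)) \<le> real ((m - i) * (q * (m + 1)))"
      by (simp only: of_nat_le_iff)
    also have "real ((m - i) * (q * (m + 1))) = real q * real (m - i) * (real m + 1)"
      by (simp only: of_nat_mult of_nat_add of_nat_1 mult_ac)
    finally have "(real m - s) * real (n - i) \<le> real q * real (m - i) * (real m + 1)"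
      using s by (simp add: of_nat_diff)
    then have "(real m - s) * real (n - i) / (real m + 1) \<le> real q * real (m - i)"
      by (subst pos_divide_le_eq) simp_all
    then show "u * real (n - i) \<le> real q * real (m - i)"
      by (simp add: u_def)
  qed (use u in auto)
  finally show "(1 - real s * (real s + 1) / (real m + 1)) * (n choose s) \<le> real q ^ s * (m choose s)" .
qed

text \<open>The coloring of the small complete hypergraph is the pullback of an optimal coloring of the
  large one along a transversal of \<open>m\<close> consecutive blocks of length \<open>q\<close>. Since
  \<^term>\<open>n choose k\<close> enters only through its logarithm, \<open>n\<close> may be as large as any fixed power
  of \<open>m\<close>.\<close>

lemma M_le_scaled:
  assumes r: "r > 0" and s: "s > 0" "s \<le> k" "s\<^sup>2 \<le> m" and k: "k \<le> m"
    and q: "q > 0" "q * m \<le> n"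
  shows "M m r k t s \<le> M n r k t s / real q ^ s
    + (m choose s) * ((ln (n choose k) + (real s)\<^sup>2) / sqrt m)"
proof -
  define K where "K = complete_hypergraph k {..<n}"
  have "m \<le> q * m" using q(1) by simp
  then have kn: "k \<le> n" using k q(2) by linarith
  have finK: "finite K" by (simp add: K_def finite_complete_hypergraph)
  have cardK: "card K = n choose k" by (simp add: K_def card_complete_hypergraph)
  have neK: "K \<noteq> {}" using kn cardK by auto
  obtain c where c: "c \<in> colorings r K" and opt: "M n r k t s = M_coloring n r k t s c"
    using obtain_optimal_coloring[OF r] unfolding K_def .
  define F where "F = (\<lambda>e. shadow s (mono_component t K c e)) ` K"
  have F: "finite F" "F \<noteq> {}" using finK neK by (auto simp: F_def)
  have finS: "finite S" if S: "S \<in> F" for S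
  proof -
    obtain e where e: "e \<in> K" "S = shadow s (mono_component t K c e)" using S by (auto simp: F_def)
    have "S \<subseteq> complete_hypergraph s {..<n}"
      using shadow_subset_complete mono_component_subset[OF e(1)] e(2) unfolding K_def by blast
    then show ?thesis by (rule finite_subset) (simp add: finite_complete_hypergraph)
  qed
  have cardS: "card S \<le> M n r k t s" if S: "S \<in> F" for S
    using S M_coloring_le_iff[OF kn c[unfolded K_def], of t s "M n r k t s"] opt
    by (auto simp: F_def K_def)
  define B where "B i = {i * q..<(i + 1) * q}" for i
  have block: "j div q = i" if "j \<in> B i" for i j
    using that by (auto simp: B_def intro!: div_nat_eqI simp: mult.commute)
  have disj: "disjoint_family_on B {..<m}"
    unfolding disjoint_family_on_def using block by blast
  obtain x where x: "x \<in> PiE {..<m} B"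
    and bound: "\<And>S. S \<in> F \<Longrightarrow> card (trace s {..<m} x S)
      \<le> card S / real q ^ s + (m choose s) * ((ln (card F) + (real s)\<^sup>2) / sqrt m)"
    using transversal_sampling[OF _ _ disj q(1) _ F finS s(1,3)] by (auto simp: B_def)
  have inj: "inj_on x {..<m}"
  proof (rule inj_onI)
    fix i j assume ij: "i \<in> {..<m}" "j \<in> {..<m}" "x i = x j"
    have "x i div q = i" "x j div q = j" using ij(1,2) block[OF PiE_mem[OF x]] by blast+
    then show "i = j" using ij(3) by metis
  qed
  have xV: "x ` {..<m} \<subseteq> {..<n}"
  proof clarify
    fix i assume i: "i < m"
    then have "x i < (i + 1) * q" using PiE_mem[OF x, of i] by (simp add: B_def)
    also have "(i + 1) * q \<le> m * q" using i by (intro mult_le_mono1) simp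
    finally show "x i < n" using q(2) by (simp add: mult.commute)
  qed
  have edge: "x ` e \<in> K" if "e \<in> complete_hypergraph k {..<m}" for e
    using that xV card_image[OF inj_on_subset[OF inj]] by (auto simp: K_def complete_hypergraph_def)
  define c' where "c' = restrict (\<lambda>e. c (x ` e)) (complete_hypergraph k {..<m})"
  have c': "c' \<in> colorings r (complete_hypergraph k {..<m})"
    using c edge by (auto simp: c'_def colorings_def)
  define b where "b = M n r k t s / real q ^ s
    + (m choose s) * ((ln (n choose k) + (real s)\<^sup>2) / sqrt m)"
  have "card F \<le> n choose k" unfolding F_def cardK[symmetric] using finK by (rule card_image_le)
  moreover have "card F > 0" using F by (simp add: card_gt_0_iff)
  ultimately have lnF: "ln (card F) \<le> ln (n choose k)"
    using kn by simp
  have "real (card (shadow s (mono_component t (complete_hypergraph k {..<m}) c' e))) \<le> b"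
    if e: "e \<in> complete_hypergraph k {..<m}" for e
  proof -
    define S where "S = shadow s (mono_component t K c (x ` e))"
    have S: "S \<in> F" using edge[OF e] by (auto simp: F_def S_def)
    have "shadow s (mono_component t (complete_hypergraph k {..<m}) c' e) \<subseteq> trace s {..<m} x S"
      unfolding S_def K_def
      by (rule shadow_pullback_subset_trace[OF inj _ xV _ e]) (auto simp: c'_def)
    then have "real (card (shadow s (mono_component t (complete_hypergraph k {..<m}) c' e)))
        \<le> card (trace s {..<m} x S)"
      by (simp add: card_mono finite_trace)
    also have "\<dots> \<le> card S / real q ^ s + (m choose s) * ((ln (card F) + (real s)\<^sup>2) / sqrt m)"
      by (rule bound[OF S])
    also have "\<dots> \<le> b"
      unfolding b_def using cardS[OF S] lnF
      by (intro add_mono mult_left_mono divide_right_mono) auto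
    finally show ?thesis .
  qed
  then have "M_coloring m r k t s c' \<le> nat \<lfloor>b\<rfloor>"
    unfolding M_coloring_le_iff[OF k c'] by (simp add: le_nat_floor)
  then have "M m r k t s \<le> nat \<lfloor>b\<rfloor>" using M_le_M_coloring[OF c', of t s] by simp
  moreover have "b \<ge> 0"
  proof -
    have "n choose k > 0" using kn by simp
    then have "ln (real (n choose k)) \<ge> 0" by (intro ln_ge_zero) (simp add: Suc_le_eq)
    then show ?thesis by (simp add: b_def)
  qed
  ultimately show ?thesis
    unfolding b_def[symmetric] by (meson of_nat_floor of_nat_mono order_trans)
qed

definition M_density :: "nat \<Rightarrow> nat \<Rightarrow> nat \<Rightarrow> nat \<Rightarrow> nat \<Rightarrow> real" where
  "M_density r k t s n = M n r k t s / (n choose s)"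

text \<open>The window of \<open>n\<close> between \<open>m\<^sup>2\<close> and \<open>m ^ 4\<close> serves two purposes. The lower end makes
  the block length \<open>n div m\<close> at least \<open>m\<close>, so that the at most \<open>m\<close> vertices outside the blocks
  are negligible; the upper end makes the logarithmic term small against \<open>sqrt m\<close>. Windows for
  \<open>m\<close> and for \<open>m\<^sup>2\<close> meet, which permits chaining.\<close>

lemma M_density_le_add_error:
  assumes r: "r > 0" and s: "s > 0" "s \<le> k" "s\<^sup>2 \<le> m" and k: "k \<le> m"
    and n: "m ^ 2 \<le> n" "n \<le> m ^ 4"
  shows "M_density r k t s m \<le> M_density r k t s n
    + (16 * real k + (real s)\<^sup>2 + real s * (real s + 1)) * real m powr (- 1/4)"
proof -
  define q where "q = n div m"
  have sm: "s \<le> m" using s(2) k by simp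
  have m: "m > 0" using s(1) sm by simp
  have mq: "m \<le> q" using n(1) m unfolding q_def
    by (metis div_le_mono div_mult_self_is_m power2_eq_square)
  have q: "q * m \<le> n" by (simp add: q_def)
  have "n < (q + 1) * m" using m unfolding q_def
    by (metis Suc_eq_plus1 dividend_less_div_times mult_Suc add.commute)
  then have q': "n \<le> q * (m + 1)" using mq by (simp add: algebra_simps)
  have "m \<le> m\<^sup>2" by (simp add: power2_eq_square)
  then have mn: "m \<le> n" using n by simp
  define b where "b = real (m choose s)"
  define b' where "b' = real (n choose s)"
  have b: "b > 0" "b' > 0" using sm mn by (auto simp: b_def b'_def)
  define \<eta> where "\<eta> = (ln (n choose k) + (real s)\<^sup>2) / sqrt m"
  define \<delta> where "\<delta> = real s * (real s + 1) / (real m + 1)"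
  \<comment> \<open>The fraction of \<open>s\<close>-sets that are transversal to the blocks.\<close>
  define \<rho> where "\<rho> = real q ^ s * b / b'"
  have \<rho>: "\<rho> \<le> 1" "1 - \<delta> \<le> \<rho>" "\<rho> \<ge> 0"
    using block_binomial_bounds[OF sm m mq q q'] b
    by (auto simp: \<rho>_def \<delta>_def b_def b'_def field_simps)
  have "1 \<le> n choose k" using k mn by (simp add: Suc_le_eq)
  then have ln0: "ln (n choose k) \<ge> 0" by (intro ln_ge_zero) simp
  then have \<eta>: "\<eta> \<ge> 0" by (simp add: \<eta>_def)
  have X: "M_density r k t s m \<le> 1" "M_density r k t s m \<ge> 0"
    using M_le_binomial[OF r k, of t s] b by (auto simp: M_density_def b_def divide_le_eq)
  have "M m r k t s \<le> M n r k t s / real q ^ s + b * \<eta>"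
    using M_le_scaled[OF r s k _ q, of t] mq m by (simp add: b_def \<eta>_def)
  then have "M_density r k t s m \<le> (M n r k t s / real q ^ s + b * \<eta>) / b"
    using b by (simp add: M_density_def divide_right_mono flip: b_def)
  then have "\<rho> * M_density r k t s m \<le> \<rho> * ((M n r k t s / real q ^ s + b * \<eta>) / b)"
    using \<rho>(3) by (rule mult_left_mono)
  also have "\<dots> = M_density r k t s n + \<rho> * \<eta>"
    using b mq m by (simp add: \<rho>_def M_density_def field_simps flip: b'_def)
  also have "\<rho> * \<eta> \<le> \<eta>" using \<rho> \<eta> mult_right_mono by fastforce
  finally have "\<rho> * M_density r k t s m \<le> M_density r k t s n + \<eta>" by simp
  moreover have "(1 - \<delta>) * M_density r k t s m \<le> \<rho> * M_density r k t s m"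
    using X \<rho> by (intro mult_right_mono) auto
  moreover have "\<delta> * M_density r k t s m \<le> \<delta>"
    using X by (intro mult_left_le) (auto simp: \<delta>_def)
  ultimately have main: "M_density r k t s m \<le> M_density r k t s n + \<eta> + \<delta>"
    by (simp add: algebra_simps)
  \<comment> \<open>In terms of the fourth root \<open>p\<close> of \<open>m\<close>, the bound \<open>ln p \<le> p\<close> controls the logarithm.\<close>
  define p where "p = real m powr (1/4)"
  have p1: "p \<ge> 1" using m by (simp add: p_def ge_one_powr_ge_zero)
  have p4: "p ^ 4 = m" using m by (simp add: p_def powr_power)
  have p2: "sqrt m = p\<^sup>2" using p4 p1 by (intro real_sqrt_unique) auto
  have pinv: "real m powr (- 1/4) = 1 / p" using m by (simp add: p_def powr_minus_divide)
  have "ln (n choose k) \<le> ln (real n ^ k)"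
    using \<open>1 \<le> n choose k\<close> binomial_le_pow[of k n] k mn by (subst ln_le_cancel_iff) (auto simp flip: of_nat_power)
  also have "\<dots> = k * ln n" using m mn by (simp add: ln_realpow)
  also have "real n \<le> real m ^ 4" using n(2) by (simp flip: of_nat_power)
  then have "k * ln n \<le> k * ln (real m ^ 4)" using m mn by (intro mult_left_mono) auto
  also have "ln (real m ^ 4) = 16 * ln p" using p1 by (simp add: ln_realpow flip: p4)
  also have "16 * ln p \<le> 16 * p" using p1 ln_bound[of p] by simp
  finally have "ln (n choose k) \<le> 16 * real k * p" by (simp add: mult_left_mono)
  then have "ln (n choose k) + (real s)\<^sup>2 \<le> (16 * real k + (real s)\<^sup>2) * p"
    using p1 by (simp add: distrib_right mult_le_cancel_left1 add_mono)
  then have "\<eta> \<le> (16 * real k + (real s)\<^sup>2) * p / p\<^sup>2"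
    unfolding \<eta>_def p2 by (rule divide_right_mono) simp
  then have "\<eta> \<le> (16 * real k + (real s)\<^sup>2) / p" using p1 by (simp add: power2_eq_square)
  moreover have "p \<le> p ^ 4" using p1 by (intro self_le_power) auto
  then have "\<delta> \<le> real s * (real s + 1) / p"
    unfolding \<delta>_def using p1 p4 by (intro divide_left_mono) auto
  moreover have "(16 * real k + (real s)\<^sup>2 + real s * (real s + 1)) * real m powr (- 1/4)
      = (16 * real k + (real s)\<^sup>2) / p + real s * (real s + 1) / p"
    unfolding pinv by (simp only: times_divide_eq_right mult_1_right add_divide_distrib)
  ultimately show ?thesis using main by linarith
qed

section \<open>Almost monotone sequences converge\<close>

text \<open>Passing from \<open>m\<close> to \<open>m\<^sup>2\<close> squares the error \<open>\<epsilon> = real m powr (- 1/4)\<close>, and \<open>m \<ge> 16\<close>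
  gives \<open>\<epsilon> \<le> 1/2\<close>. Hence the errors along \<open>m\<close>, \<open>m\<^sup>2\<close>, \<open>m ^ 4\<close>, ... are dominated by a
  geometric series with ratio \<open>1/2\<close> and add up to at most twice the first one.\<close>

lemma chain_squares:
  fixes X :: "nat \<Rightarrow> real"
  assumes D: "D \<ge> 0" and m0: "m0 \<ge> 16"
    and step: "\<And>m n. m0 \<le> m \<Longrightarrow> m ^ 2 \<le> n \<Longrightarrow> n \<le> m ^ 4 \<Longrightarrow> X m \<le> X n + D * real m powr (- 1/4)"
    and "m0 \<le> m" "m ^ 2 \<le> n"
  shows "X m \<le> X n + 2 * D * real m powr (- 1/4)"
  using \<open>m0 \<le> m\<close> \<open>m ^ 2 \<le> n\<close>
proof (induction "n - m" arbitrary: m rule: less_induct)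
  case less
  define \<epsilon> where "\<epsilon> = real m powr (- 1/4)"
  have m: "m \<ge> 16" using less.prems m0 by simp
  show ?case
  proof (cases "n \<le> m ^ 4")
    case True
    have "D * \<epsilon> \<ge> 0" using D by (simp add: \<epsilon>_def)
    then show ?thesis using step[OF less.prems True] unfolding \<epsilon>_def[symmetric] by simp
  next
    case False
    have sq: "m < m\<^sup>2" using m by (simp add: power2_eq_square)
    have "m\<^sup>2 \<le> m ^ 4" using m by (intro power_increasing) auto
    then have 1: "X m \<le> X (m\<^sup>2) + D * \<epsilon>"
      unfolding \<epsilon>_def using less.prems by (intro step) auto
    have "X (m\<^sup>2) \<le> X n + 2 * D * real (m\<^sup>2) powr (- 1/4)"
      using False sq less.prems by (intro less.hyps) (auto simp flip: power_mult)
    also have "real (m\<^sup>2) powr (- 1/4) = \<epsilon> * \<epsilon>"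
      using m by (simp add: \<epsilon>_def power2_eq_square powr_mult)
    finally have 2: "X (m\<^sup>2) \<le> X n + 2 * D * (\<epsilon> * \<epsilon>)" .
    have "\<epsilon> \<le> 16 powr (- 1/4)" unfolding \<epsilon>_def using m by (intro powr_mono2') auto
    also have "(16::real) powr (- 1/4) = (2 powr 4) powr (- 1/4)" by simp
    also have "\<dots> = 1 / 2" by (subst powr_powr) (simp add: powr_minus_divide)
    finally have "2 * D * \<epsilon> * \<epsilon> \<le> 2 * D * \<epsilon> * (1 / 2)"
      using D by (intro mult_left_mono) (auto simp: \<epsilon>_def)
    then show ?thesis using 1 2 unfolding \<epsilon>_def[symmetric] by simp
  qed
qed

text \<open>The limit is the supremum of the numbers \<open>X m - e m\<close>: each of them is a lower bound
  for all late terms of the sequence, and no term exceeds the supremum by more than its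
  own error.\<close>

lemma convergent_if_almost_mono:
  fixes X e :: "nat \<Rightarrow> real"
  assumes e: "e \<longlonglongrightarrow> 0" and bound: "\<And>n. n \<ge> m0 \<Longrightarrow> X n \<le> b"
    and le: "\<And>m n. m \<ge> m0 \<Longrightarrow> n \<ge> N m \<Longrightarrow> X m \<le> X n + e m"
  shows "convergent X"
proof -
  define A where "A = (\<lambda>m. X m - e m) ` {m0..}"
  have bdd: "bdd_above A"
  proof (rule bdd_aboveI)
    fix y assume "y \<in> A"
    then obtain m where "m \<ge> m0" "y = X m - e m" by (auto simp: A_def)
    then show "y \<le> b" using le[of m "max m0 (N m)"] bound[of "max m0 (N m)"] by simp
  qed
  have "X \<longlonglongrightarrow> Sup A"
  proof (rule LIMSEQ_I)
    fix \<epsilon> :: real assume \<epsilon>: "\<epsilon> > 0"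
    obtain y where "y \<in> A" "Sup A - \<epsilon> < y"
      using less_cSup_iff[OF _ bdd, of "Sup A - \<epsilon>"] \<epsilon> by (auto simp: A_def)
    then obtain m where m: "m \<ge> m0" "Sup A - \<epsilon> < X m - e m" by (auto simp: A_def)
    obtain n0 where n0: "\<And>n. n \<ge> n0 \<Longrightarrow> \<bar>e n\<bar> < \<epsilon>"
      using LIMSEQ_D[OF e \<epsilon>] by auto
    have "norm (X n - Sup A) < \<epsilon>" if n: "n \<ge> max (max m0 n0) (N m)" for n
    proof -
      have "X n - e n \<le> Sup A" using n bdd by (intro cSup_upper) (auto simp: A_def)
      moreover have "\<bar>e n\<bar> < \<epsilon>" using n0 n by simp
      moreover have "X m \<le> X n + e m" using le m n by simp
      ultimately show ?thesis using m by simp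
    qed
    then show "\<exists>no. \<forall>n\<ge>no. norm (X n - Sup A) < \<epsilon>" by blast
  qed
  then show ?thesis by (rule convergentI)
qed

theorem theorem1p3:
  fixes r k t s :: nat
  assumes "r > 0" "k > 0" "t > 0" "s > 0"
    and "max (t + 1) s \<le> k"
  shows "\<exists>\<Lambda>::real. (\<lambda>n. inverse (real (n choose s)) * real (M n r k t s)) \<longlonglongrightarrow> \<Lambda>"
proof -
  define m0 where "m0 = k + s\<^sup>2 + 16"
  define D where "D = 16 * real k + (real s)\<^sup>2 + real s * (real s + 1)"
  have "M_density r k t s m \<le> M_density r k t s n + D * real m powr (- 1/4)"
    if "m0 \<le> m" "m ^ 2 \<le> n" "n \<le> m ^ 4" for m n
    unfolding D_def by (rule M_density_le_add_error) (use assms that in \<open>auto simp: m0_def\<close>)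
  then have chain: "M_density r k t s m \<le> M_density r k t s n + 2 * D * real m powr (- 1/4)"
    if "m0 \<le> m" "m ^ 2 \<le> n" for m n
    using that by (intro chain_squares[of D m0]) (auto simp: D_def m0_def)
  have "((\<lambda>m. real m powr (- 1/4)) \<longlonglongrightarrow> 0)"
    by (intro tendsto_neg_powr filterlim_real_sequentially) simp
  then have error: "(\<lambda>m. 2 * D * real m powr (- 1/4)) \<longlonglongrightarrow> 0"
    by (rule tendsto_mult_right_zero)
  have "M_density r k t s n \<le> 1" if "n \<ge> m0" for n
  proof -
    have "M n r k t s \<le> n choose s" using assms(1) that by (intro M_le_binomial) (simp_all add: m0_def)
    then show ?thesis by (auto simp: M_density_def divide_le_eq_1)
  qed
  then have "convergent (M_density r k t s)"
    using chain by (rule convergent_if_almost_mono[OF error])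
  moreover have "(\<lambda>n. inverse (real (n choose s)) * real (M n r k t s)) = M_density r k t s"
    by (simp add: fun_eq_iff M_density_def divide_inverse mult.commute)
  ultimately show ?thesis by (simp add: convergent_def)
qed

end
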